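(* (a) A real Banach space $X$ has property (D) if and only if each symmetric operator $T\colon X\to X^*$ is factorizable through a Hilbert space. (b) Property (D) passes to quotients, and hence also to complemented subspaces: if a Banach space $X$ has property (D), then $X/L$ has property (D) for every closed subspace $L$ of $X$, and every complemented subspace of $X$ has property (D).
   Context: All Banach spaces are real; "operator" means bounded linear operator. A function $q\colon X\to\mathbb{R}$ is a continuous quadratic form if there is a continuous bilinear form $b\colon X\times X\to\mathbb{R}$ with $q(x)=b(x,x)$ for all $x$. A continuous quadratic form is delta-semidefinite if it is the difference of two nonnegative continuous quadratic forms on $X$. Property (D) of $X$: each continuous quadratic form on $X$ is delta-semidefinite. An operator $T\colon X\to X^*$ is symmetric if $\langle Tx,y\rangle=\langle Ty,x\rangle$ for all $x,y\in X$. An operator $T\colon X\to Y$ is factorizable through $Z$ if there are operators $A\colon X\to Z$ and $B\colon Z\to Y$ with $T=BA$. *)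

theory Defs
  imports "HOL-Analysis.Analysis"
begin

text \<open>
  The spaces \<open>X\<close> of the theory are types of class \<^class>\<open>banach\<close>. The quotients and subspaces of \<open>X\<close>,
  and the Hilbert spaces over which one quantifies existentially, depend on terms and hence cannot
  be types; they are given by an explicit carrier with explicit operations. All conditions below
  constrain operations and functions only on the carrier.
\<close>

record 'v nspace =
  points :: "'v set"
  zer :: 'v
  add :: "'v \<Rightarrow> 'v \<Rightarrow> 'v"
  scl :: "real \<Rightarrow> 'v \<Rightarrow> 'v"
  nrm :: "'v \<Rightarrow> real"

definition real_vector_space :: "'v nspace \<Rightarrow> bool" where
  "real_vector_space V \<longleftrightarrow>
     zer V \<in> points V \<and>
     (\<forall>x\<in>points V. \<forall>y\<in>points V. add V x y \<in> points V) \<and>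
     (\<forall>c. \<forall>x\<in>points V. scl V c x \<in> points V) \<and>
     (\<forall>x\<in>points V. \<forall>y\<in>points V. \<forall>z\<in>points V. add V (add V x y) z = add V x (add V y z)) \<and>
     (\<forall>x\<in>points V. \<forall>y\<in>points V. add V x y = add V y x) \<and>
     (\<forall>x\<in>points V. add V (zer V) x = x) \<and>
     (\<forall>x\<in>points V. add V x (scl V (- 1) x) = zer V) \<and>
     (\<forall>c. \<forall>x\<in>points V. \<forall>y\<in>points V. scl V c (add V x y) = add V (scl V c x) (scl V c y)) \<and>
     (\<forall>c d. \<forall>x\<in>points V. scl V (c + d) x = add V (scl V c x) (scl V d x)) \<and>
     (\<forall>c d. \<forall>x\<in>points V. scl V c (scl V d x) = scl V (c * d) x) \<and>
     (\<forall>x\<in>points V. scl V 1 x = x)"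

definition real_normed_space :: "'v nspace \<Rightarrow> bool" where
  "real_normed_space V \<longleftrightarrow> real_vector_space V \<and>
     (\<forall>x\<in>points V. nrm V x \<ge> 0) \<and>
     (\<forall>x\<in>points V. nrm V x = 0 \<longleftrightarrow> x = zer V) \<and>
     (\<forall>x\<in>points V. \<forall>y\<in>points V. nrm V (add V x y) \<le> nrm V x + nrm V y) \<and>
     (\<forall>c. \<forall>x\<in>points V. nrm V (scl V c x) = \<bar>c\<bar> * nrm V x)"

definition dst :: "'v nspace \<Rightarrow> 'v \<Rightarrow> 'v \<Rightarrow> real" where
  "dst V x y = nrm V (add V x (scl V (- 1) y))"

definition banach_space :: "'v nspace \<Rightarrow> bool" where
  "banach_space V \<longleftrightarrow> real_normed_space V \<and>
     (\<forall>s. (\<forall>n::nat. s n \<in> points V) \<and>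
          (\<forall>e>0. \<exists>N. \<forall>m\<ge>N. \<forall>n\<ge>N. dst V (s m) (s n) < e) \<longrightarrow>
          (\<exists>l\<in>points V. (\<lambda>n. dst V (s n) l) \<longlonglongrightarrow> 0))"

definition norm_inner :: "'v nspace \<Rightarrow> ('v \<Rightarrow> 'v \<Rightarrow> real) \<Rightarrow> bool" where
  "norm_inner V p \<longleftrightarrow>
     (\<forall>x\<in>points V. \<forall>y\<in>points V. p x y = p y x) \<and>
     (\<forall>x\<in>points V. \<forall>y\<in>points V. \<forall>z\<in>points V. p (add V x y) z = p x z + p y z) \<and>
     (\<forall>c. \<forall>x\<in>points V. \<forall>y\<in>points V. p (scl V c x) y = c * p x y) \<and>
     (\<forall>x\<in>points V. p x x = (nrm V x)\<^sup>2)"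

definition hilbert_space :: "'v nspace \<Rightarrow> bool" where
  "hilbert_space V \<longleftrightarrow> banach_space V \<and> (\<exists>p. norm_inner V p)"

definition induced :: "'a::real_normed_vector set \<Rightarrow> 'a nspace" where
  "induced S = \<lparr>points = S, zer = 0, add = (+), scl = (*\<^sub>R), nrm = norm\<rparr>"

text \<open>
  The points of the quotient by \<open>L\<close> are the cosets of \<open>L\<close>. Adding \<open>L\<close> in the scalar multiplication
  is needed for the scalar \<open>0\<close> only.
\<close>

definition quotient_space :: "'a::real_normed_vector set \<Rightarrow> 'a set nspace" where
  "quotient_space L =
     \<lparr>points = range (\<lambda>x. (+) x ` L),
      zer = L,
      add = (\<lambda>A B. {a + b | a b. a \<in> A \<and> b \<in> B}),
      scl = (\<lambda>c A. {c *\<^sub>R a + l | a l. a \<in> A \<and> l \<in> L}),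
      nrm = (\<lambda>A. INF a\<in>A. norm a)\<rparr>"

definition complemented_subspace :: "'a::real_normed_vector set \<Rightarrow> bool" where
  "complemented_subspace Y \<longleftrightarrow> subspace Y \<and>
     (\<exists>P :: 'a \<Rightarrow>\<^sub>L 'a. range (blinfun_apply P) = Y \<and> (\<forall>y\<in>Y. P y = y))"

text \<open>Continuity of linear operators and of bilinear forms is expressed by a bound, as in
  \<^const>\<open>bounded_linear\<close> and \<^const>\<open>bounded_bilinear\<close>.\<close>

definition bounded_operator :: "'v nspace \<Rightarrow> 'w nspace \<Rightarrow> ('v \<Rightarrow> 'w) \<Rightarrow> bool" where
  "bounded_operator V W f \<longleftrightarrow>
     (\<forall>x\<in>points V. f x \<in> points W) \<and>
     (\<forall>x\<in>points V. \<forall>y\<in>points V. f (add V x y) = add W (f x) (f y)) \<and>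
     (\<forall>c. \<forall>x\<in>points V. f (scl V c x) = scl W c (f x)) \<and>
     (\<exists>K. \<forall>x\<in>points V. nrm W (f x) \<le> K * nrm V x)"

definition continuous_bilinear_form :: "'v nspace \<Rightarrow> ('v \<Rightarrow> 'v \<Rightarrow> real) \<Rightarrow> bool" where
  "continuous_bilinear_form V b \<longleftrightarrow>
     (\<forall>x\<in>points V. \<forall>y\<in>points V. \<forall>z\<in>points V.
        b (add V x y) z = b x z + b y z \<and> b z (add V x y) = b z x + b z y) \<and>
     (\<forall>c. \<forall>x\<in>points V. \<forall>y\<in>points V.
        b (scl V c x) y = c * b x y \<and> b x (scl V c y) = c * b x y) \<and>
     (\<exists>K. \<forall>x\<in>points V. \<forall>y\<in>points V. \<bar>b x y\<bar> \<le> nrm V x * nrm V y * K)"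

definition continuous_quadratic_form :: "'v nspace \<Rightarrow> ('v \<Rightarrow> real) \<Rightarrow> bool" where
  "continuous_quadratic_form V q \<longleftrightarrow>
     (\<exists>b. continuous_bilinear_form V b \<and> (\<forall>x\<in>points V. q x = b x x))"

definition delta_semidefinite :: "'v nspace \<Rightarrow> ('v \<Rightarrow> real) \<Rightarrow> bool" where
  "delta_semidefinite V q \<longleftrightarrow>
     (\<exists>q1 q2. continuous_quadratic_form V q1 \<and> (\<forall>x\<in>points V. q1 x \<ge> 0) \<and>
              continuous_quadratic_form V q2 \<and> (\<forall>x\<in>points V. q2 x \<ge> 0) \<and>
              (\<forall>x\<in>points V. q x = q1 x - q2 x))"

definition property_D :: "'v nspace \<Rightarrow> bool" where
  "property_D V \<longleftrightarrow> (\<forall>q. continuous_quadratic_form V q \<longrightarrow> delta_semidefinite V q)"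

definition symmetric_operator ::
    "('a::real_normed_vector \<Rightarrow>\<^sub>L ('a \<Rightarrow>\<^sub>L real)) \<Rightarrow> bool" where
  "symmetric_operator T \<longleftrightarrow> (\<forall>x y. blinfun_apply (T x) y = blinfun_apply (T y) x)"

definition factorizable_through ::
    "('a::real_normed_vector \<Rightarrow>\<^sub>L 'b::real_normed_vector) \<Rightarrow> 'v nspace \<Rightarrow> bool" where
  "factorizable_through T Z \<longleftrightarrow>
     (\<exists>A B. bounded_operator (induced UNIV) Z A \<and> bounded_operator Z (induced UNIV) B \<and>
            (\<forall>x. T x = B (A x)))"

text \<open>
  An existential quantifier cannot range over Hilbert spaces in all types, so the points of \<open>Z\<close>
  are taken from one fixed type, with arbitrary operations. This is no restriction:
  the lemma \<open>factorizable_through_hilbertI\<close> below shows that a factorization through a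
  Hilbert space with points in any type whatsoever yields one of this kind.
\<close>

definition factorizable_through_hilbert ::
    "('a::real_normed_vector \<Rightarrow>\<^sub>L 'b::real_normed_vector) \<Rightarrow> bool" where
  "factorizable_through_hilbert T \<longleftrightarrow>
     (\<exists>Z :: ('a \<Rightarrow>\<^sub>L real) nspace. hilbert_space Z \<and> factorizable_through T Z)"

lemma induced_simps [simp]:
  "points (induced S) = S" "zer (induced S) = 0" "add (induced S) = (+)"
  "scl (induced S) = (*\<^sub>R)" "nrm (induced S) = norm"
  by (simp_all add: induced_def)

lemma bounded_operator_UNIV:
  "bounded_operator (induced UNIV) (induced UNIV) f \<longleftrightarrow> bounded_linear f"
  unfolding bounded_operator_def bounded_linear_def bounded_linear_axioms_def linear_iff
  by (auto simp: mult.commute)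

lemma continuous_bilinear_form_UNIV:
  "continuous_bilinear_form (induced UNIV) b \<longleftrightarrow> bounded_bilinear b"
  unfolding continuous_bilinear_form_def bounded_bilinear_def by auto

lemma banach_space_induced:
  fixes S :: "'a::banach set"
  assumes "closed S" "subspace S"
  shows "banach_space (induced S)"
proof -
  have "real_normed_space (induced S)"
    using assms(2) unfolding real_normed_space_def real_vector_space_def
    by (auto simp: subspace_0 subspace_add subspace_mul algebra_simps norm_triangle_ineq)
  moreover have "\<exists>l\<in>S. (\<lambda>n. dst (induced S) (s n) l) \<longlonglongrightarrow> 0"
    if s: "\<forall>n. s n \<in> S"
      and C: "\<forall>e>0. \<exists>N. \<forall>m\<ge>N. \<forall>n\<ge>N. dst (induced S) (s m) (s n) < e" for s :: "nat \<Rightarrow> 'a"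
  proof -
    have "Cauchy s"
      using C by (simp add: Cauchy_def dst_def dist_norm)
    then obtain l where l: "s \<longlonglongrightarrow> l"
      using Cauchy_convergent convergentD by blast
    with s assms(1) have "l \<in> S"
      by (meson closed_sequentially)
    moreover have "(\<lambda>n. dst (induced S) (s n) l) \<longlonglongrightarrow> 0"
      using l by (simp add: dst_def LIM_zero tendsto_norm_zero)
    ultimately show ?thesis by blast
  qed
  ultimately show ?thesis by (simp add: banach_space_def)
qed

lemma hilbert_space_UNIV:
  "hilbert_space (induced (UNIV :: 'h::{real_inner, complete_space} set))"
proof -
  have "norm_inner (induced (UNIV :: 'h set)) inner"
    by (auto simp: norm_inner_def inner_commute inner_add_left inner_add_right power2_norm_eq_inner)
  moreover have "real_normed_space (induced (UNIV :: 'h set))"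
    unfolding real_normed_space_def real_vector_space_def
    by (auto simp: algebra_simps norm_triangle_ineq)
  moreover have "\<exists>l. (\<lambda>n. dst (induced UNIV) (s n) l) \<longlonglongrightarrow> 0"
    if C: "\<forall>e>0. \<exists>N. \<forall>m\<ge>N. \<forall>n\<ge>N. dst (induced UNIV) (s m) (s n) < e" for s :: "nat \<Rightarrow> 'h"
  proof -
    have "Cauchy s"
      using C by (simp add: Cauchy_def dst_def dist_norm)
    then obtain l where l: "s \<longlonglongrightarrow> l"
      using Cauchy_convergent convergentD by blast
    then have "(\<lambda>n. dst (induced UNIV) (s n) l) \<longlonglongrightarrow> 0"
      by (simp add: dst_def LIM_zero tendsto_norm_zero)
    then show ?thesis by blast
  qed
  ultimately show ?thesis unfolding hilbert_space_def banach_space_def by auto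
qed

lemma quotient_space_cosets:
  fixes L :: "'a::real_normed_vector set"
  assumes "subspace L"
  shows "add (quotient_space L) ((+) x ` L) ((+) y ` L) = (+) (x + y) ` L"
    and "scl (quotient_space L) c ((+) x ` L) = (+) (c *\<^sub>R x) ` L"
    and "nrm (quotient_space L) ((+) x ` L) = infdist x L"
proof -
  show "add (quotient_space L) ((+) x ` L) ((+) y ` L) = (+) (x + y) ` L"
  proof
    show "add (quotient_space L) ((+) x ` L) ((+) y ` L) \<subseteq> (+) (x + y) ` L"
    proof
      fix z assume "z \<in> add (quotient_space L) ((+) x ` L) ((+) y ` L)"
      then obtain k l where kl: "k \<in> L" "l \<in> L" "z = (x + k) + (y + l)"
        by (auto simp: quotient_space_def)
      then have "z = (x + y) + (k + l)" by simp
      then show "z \<in> (+) (x + y) ` L" using kl assms subspace_add by blast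
    qed
    show "(+) (x + y) ` L \<subseteq> add (quotient_space L) ((+) x ` L) ((+) y ` L)"
    proof
      fix z assume "z \<in> (+) (x + y) ` L"
      then obtain l where "l \<in> L" "z = (x + 0) + (y + l)" by (auto simp: add.assoc)
      then show "z \<in> add (quotient_space L) ((+) x ` L) ((+) y ` L)"
        using subspace_0[OF assms] unfolding quotient_space_def by force
    qed
  qed
  show "scl (quotient_space L) c ((+) x ` L) = (+) (c *\<^sub>R x) ` L"
  proof
    show "scl (quotient_space L) c ((+) x ` L) \<subseteq> (+) (c *\<^sub>R x) ` L"
    proof
      fix z assume "z \<in> scl (quotient_space L) c ((+) x ` L)"
      then obtain k l where kl: "k \<in> L" "l \<in> L" "z = c *\<^sub>R (x + k) + l"
        by (auto simp: quotient_space_def)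
      then have "z = c *\<^sub>R x + (c *\<^sub>R k + l)" by (simp add: algebra_simps)
      then show "z \<in> (+) (c *\<^sub>R x) ` L"
        using kl assms subspace_add subspace_mul by blast
    qed
    show "(+) (c *\<^sub>R x) ` L \<subseteq> scl (quotient_space L) c ((+) x ` L)"
      using subspace_0[OF assms] unfolding quotient_space_def by force
  qed
  have "(\<lambda>l. norm (x + l)) ` L = dist x ` L"
  proof -
    have "dist x ` L = dist x ` (uminus ` L)"
      using assms by (metis subspace_neg image_subset_iff equalityI minus_minus subsetI image_eqI)
    then show ?thesis by (simp add: image_image dist_norm)
  qed
  then show "nrm (quotient_space L) ((+) x ` L) = infdist x L"
    using subspace_0[OF assms] by (auto simp: quotient_space_def infdist_def image_image)
qed

lemma norm_inner_Cauchy_Schwarz: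
  assumes V: "real_normed_space V" and p: "norm_inner V p"
    and x: "x \<in> points V" and y: "y \<in> points V"
  shows "\<bar>p x y\<bar> \<le> nrm V x * nrm V y"
proof -
  have cl: "\<And>c z. z \<in> points V \<Longrightarrow> scl V c z \<in> points V"
    "\<And>z w. z \<in> points V \<Longrightarrow> w \<in> points V \<Longrightarrow> add V z w \<in> points V"
    and nn: "\<And>z. z \<in> points V \<Longrightarrow> nrm V z \<ge> 0"
    using V by (auto simp: real_normed_space_def real_vector_space_def)
  have sym: "\<And>z w. z \<in> points V \<Longrightarrow> w \<in> points V \<Longrightarrow> p z w = p w z"
    and pa: "\<And>u z w. u \<in> points V \<Longrightarrow> z \<in> points V \<Longrightarrow> w \<in> points V \<Longrightarrow> p (add V u z) w = p u w + p z w"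
    and ps: "\<And>c z w. z \<in> points V \<Longrightarrow> w \<in> points V \<Longrightarrow> p (scl V c z) w = c * p z w"
    and pp: "\<And>z. z \<in> points V \<Longrightarrow> p z z = (nrm V z)\<^sup>2"
    using p by (auto simp: norm_inner_def)
  have q: "0 \<le> a\<^sup>2 * (nrm V x)\<^sup>2 + 2 * a * c * p x y + c\<^sup>2 * (nrm V y)\<^sup>2" for a c
  proof -
    let ?z = "add V (scl V a x) (scl V c y)"
    have z: "?z \<in> points V" using x y cl by blast
    have "p ?z ?z = a * p x ?z + c * p y ?z"
      using x y z cl pa ps by simp
    also have "p x ?z = a * p x x + c * p x y"
      using x y z cl pa ps sym by metis
    also have "p y ?z = a * p x y + c * p y y"
      using x y z cl pa ps sym by metis
    finally have "p ?z ?z = a\<^sup>2 * (nrm V x)\<^sup>2 + 2 * a * c * p x y + c\<^sup>2 * (nrm V y)\<^sup>2"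
      using pp x y by (simp add: power2_eq_square algebra_simps)
    moreover have "p ?z ?z \<ge> 0" using pp z by simp
    ultimately show ?thesis by simp
  qed
  have sq: "(p x y)\<^sup>2 \<le> (nrm V x)\<^sup>2 * (nrm V y)\<^sup>2"
  proof (cases "nrm V y = 0")
    case False
    have "0 \<le> (nrm V y)\<^sup>2 * ((nrm V x)\<^sup>2 * (nrm V y)\<^sup>2 - (p x y)\<^sup>2)"
      using q[of "(nrm V y)\<^sup>2" "- p x y"] by (simp add: power2_eq_square algebra_simps)
    then show ?thesis using False by (simp add: zero_le_mult_iff)
  next
    case True
    have "p x y = 0"
    proof (rule ccontr)
      assume n: "p x y \<noteq> 0"
      show False
        using q[of 1 "- ((nrm V x)\<^sup>2 + 1) / (2 * p x y)"] n True by (simp add: field_simps)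
    qed
    then show ?thesis by simp
  qed
  then show ?thesis
    using nn x y by (metis abs_le_square_iff abs_of_nonneg mult_nonneg_nonneg power_mult_distrib)
qed

lemma factorizable_through_hilbertI:
  fixes T :: "'a::real_normed_vector \<Rightarrow>\<^sub>L 'b::real_normed_vector" and Z :: "'v nspace"
  assumes Z: "hilbert_space Z" and T: "factorizable_through T Z"
  shows "factorizable_through_hilbert T"
proof -
  let ?V = "points Z"
  obtain A B where A: "bounded_operator (induced UNIV) Z A" and B: "bounded_operator Z (induced UNIV) B"
    and TBA: "\<And>x. T x = B (A x)"
    using T by (auto simp: factorizable_through_def)
  obtain p where p: "norm_inner Z p" and ban: "banach_space Z"
    using Z by (auto simp: hilbert_space_def)
  have ns: "real_normed_space Z" using ban by (simp add: banach_space_def)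
  have z0: "zer Z \<in> ?V"
    and ac: "\<And>x y. x \<in> ?V \<Longrightarrow> y \<in> ?V \<Longrightarrow> add Z x y \<in> ?V"
    and sc: "\<And>c x. x \<in> ?V \<Longrightarrow> scl Z c x \<in> ?V"
    and neg: "\<And>x. x \<in> ?V \<Longrightarrow> add Z x (scl Z (- 1) x) = zer Z"
    and com: "\<And>x y. x \<in> ?V \<Longrightarrow> y \<in> ?V \<Longrightarrow> add Z x y = add Z y x"
    and asc: "\<And>x y z. x \<in> ?V \<Longrightarrow> y \<in> ?V \<Longrightarrow> z \<in> ?V \<Longrightarrow> add Z (add Z x y) z = add Z x (add Z y z)"
    and zl: "\<And>x. x \<in> ?V \<Longrightarrow> add Z (zer Z) x = x"
    using ns by (auto simp: real_normed_space_def real_vector_space_def)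
  have nn: "\<And>z. z \<in> ?V \<Longrightarrow> nrm Z z \<ge> 0"
    and n0: "\<And>z. z \<in> ?V \<Longrightarrow> nrm Z z = 0 \<longleftrightarrow> z = zer Z"
    and nt: "\<And>x y. x \<in> ?V \<Longrightarrow> y \<in> ?V \<Longrightarrow> nrm Z (add Z x y) \<le> nrm Z x + nrm Z y"
    and nm: "\<And>c x. x \<in> ?V \<Longrightarrow> nrm Z (scl Z c x) = \<bar>c\<bar> * nrm Z x"
    using ns by (auto simp: real_normed_space_def)
  have sym: "\<And>z w. z \<in> ?V \<Longrightarrow> w \<in> ?V \<Longrightarrow> p z w = p w z"
    and pa: "\<And>u z w. u \<in> ?V \<Longrightarrow> z \<in> ?V \<Longrightarrow> w \<in> ?V \<Longrightarrow> p (add Z u z) w = p u w + p z w"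
    and ps: "\<And>c z w. z \<in> ?V \<Longrightarrow> w \<in> ?V \<Longrightarrow> p (scl Z c z) w = c * p z w"
    and pp: "\<And>z. z \<in> ?V \<Longrightarrow> p z z = (nrm Z z)\<^sup>2"
    using p by (auto simp: norm_inner_def)
  have cs: "\<And>x y. x \<in> ?V \<Longrightarrow> y \<in> ?V \<Longrightarrow> \<bar>p x y\<bar> \<le> nrm Z x * nrm Z y"
    using norm_inner_Cauchy_Schwarz[OF ns p] .
  have AV: "\<And>x. A x \<in> ?V" and Aa: "\<And>x y. A (x + y) = add Z (A x) (A y)"
    and As: "\<And>c x. A (c *\<^sub>R x) = scl Z c (A x)"
    using A by (auto simp: bounded_operator_def)
  obtain K where K: "\<And>x. nrm Z (A x) \<le> K * norm x"
    using A by (auto simp: bounded_operator_def)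
  have pA: "p z (A (x + y)) = p z (A x) + p z (A y)" "p z (A (c *\<^sub>R x)) = c * p z (A x)"
    if "z \<in> ?V" for z x y c
    using that AV sym pa ps Aa As ac sc by metis+

  text \<open>The bi-annihilator \<open>W\<close> of the range of \<open>A\<close> embeds into the dual via \<open>J\<close>.\<close>
  define W where "W = {z \<in> ?V. \<forall>w\<in>?V. (\<forall>x. p w (A x) = 0) \<longrightarrow> p z w = 0}"
  define J where "J z = Blinfun (\<lambda>x. p z (A x))" for z
  have WV: "\<And>z. z \<in> W \<Longrightarrow> z \<in> ?V" by (simp add: W_def)
  have AW: "A x \<in> W" for x using AV sym by (auto simp: W_def)
  have Wa: "\<And>x y. x \<in> W \<Longrightarrow> y \<in> W \<Longrightarrow> add Z x y \<in> W" using ac pa by (auto simp: W_def)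
  have Ws: "\<And>c x. x \<in> W \<Longrightarrow> scl Z c x \<in> W" using sc ps by (auto simp: W_def)
  have W0: "zer Z \<in> W" using neg[OF AV] AW Wa Ws by metis
  have J: "blinfun_apply (J z) x = p z (A x)" if z: "z \<in> ?V" for z x
  proof -
    have "bounded_linear (\<lambda>x. p z (A x))"
    proof (rule bounded_linear_intro)
      fix x y c
      show "p z (A (x + y)) = p z (A x) + p z (A y)" using pA z by blast
      show "p z (A (c *\<^sub>R x)) = c *\<^sub>R p z (A x)" using pA z by simp
      have "\<bar>p z (A x)\<bar> \<le> nrm Z z * nrm Z (A x)" using cs z AV by blast
      also have "\<dots> \<le> nrm Z z * (K * norm x)" using K nn z by (simp add: mult_left_mono)
      finally show "norm (p z (A x)) \<le> norm x * (nrm Z z * K)" by (simp add: mult_ac)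
    qed
    then show ?thesis by (simp add: J_def bounded_linear_Blinfun_apply)
  qed
  have Ja: "J (add Z z w) = J z + J w" if "z \<in> W" "w \<in> W" for z w
    using that WV AV J ac pa by (intro blinfun_eqI) (simp add: blinfun.add_left)
  have Js: "J (scl Z c z) = c *\<^sub>R J z" if "z \<in> W" for z c
    using that WV AV J sc ps by (intro blinfun_eqI) (simp add: blinfun.scaleR_left)
  have J0: "J (zer Z) = 0"
    using Ja[OF W0 W0] zl[OF z0] by simp
  have inj: "inj_on J W"
  proof (rule inj_onI)
    fix z w assume z: "z \<in> W" and w: "w \<in> W" and e: "J z = J w"
    let ?d = "add Z z (scl Z (- 1) w)"
    have d: "?d \<in> W" using z w Wa Ws by blast
    have "J ?d = 0" using Ja Js z w Ws e by simp
    then have "\<forall>x. p ?d (A x) = 0" using J d WV by (metis zero_blinfun.rep_eq)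
    then have "p ?d ?d = 0" using d by (auto simp: W_def)
    then have d0: "?d = zer Z" using pp n0 d WV by (metis zero_eq_power2)
    have "z = add Z z (zer Z)" using com zl z z0 WV by metis
    also have "\<dots> = add Z z (add Z (scl Z (- 1) w) w)" using neg com w sc WV by metis
    also have "\<dots> = add Z ?d w" using asc z w sc WV by metis
    also have "\<dots> = w" using d0 zl w WV by simp
    finally show "z = w" .
  qed
  define I where "I = inv_into W J"
  have IJ: "\<And>z. z \<in> W \<Longrightarrow> I (J z) = z" using inj by (simp add: I_def)
  define H :: "('a \<Rightarrow>\<^sub>L real) nspace"
    where "H = \<lparr>points = J ` W, zer = 0, add = (+), scl = (*\<^sub>R), nrm = (\<lambda>f. nrm Z (I f))\<rparr>"
  have H [simp]: "points H = J ` W" "zer H = 0" "add H = (+)" "scl H = (*\<^sub>R)"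
    "nrm H = (\<lambda>f. nrm Z (I f))" by (simp_all add: H_def)
  have cla: "J z + J w \<in> J ` W" "I (J z + J w) = add Z z w" if "z \<in> W" "w \<in> W" for z w
    using that Ja Wa IJ by (metis imageI, metis)
  have cls: "c *\<^sub>R J z \<in> J ` W" "I (c *\<^sub>R J z) = scl Z c z" if "z \<in> W" for z c
    using that Js Ws IJ by (metis imageI, metis)
  have rvs: "real_vector_space H"
  proof -
    have "0 \<in> J ` W" using J0 W0 by (metis imageI)
    then show ?thesis
      using cla(1) cls(1) unfolding real_vector_space_def by (auto simp: algebra_simps)
  qed
  have rns: "real_normed_space H"
  proof -
    have "nrm Z z = 0 \<longleftrightarrow> J z = 0" if "z \<in> W" for z
      using n0 that WV J0 inj W0 by (metis inj_onD)
    then show ?thesis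
      unfolding real_normed_space_def using rvs nn nt nm WV by (auto simp: IJ cla cls)
  qed
  have ni: "norm_inner H (\<lambda>f g. p (I f) (I g))"
    unfolding norm_inner_def using sym pa ps pp WV by (auto simp: IJ cla cls)
  have dst: "dst H (J z) (J w) = dst Z z w" if "z \<in> W" "w \<in> W" for z w
    using that Ja Js Ws Wa IJ by (simp add: dst_def) (metis Js scaleR_minus1_left add_uminus_conv_diff)
  have comp: "\<exists>l\<in>points H. (\<lambda>n. dst H (s n) l) \<longlonglongrightarrow> 0"
    if s: "\<forall>n. s n \<in> points H" and C: "\<forall>e>0. \<exists>N. \<forall>m\<ge>N. \<forall>n\<ge>N. dst H (s m) (s n) < e"
    for s :: "nat \<Rightarrow> 'a \<Rightarrow>\<^sub>L real"
  proof -
    define t where "t n = I (s n)" for n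
    have t: "t n \<in> W" "s n = J (t n)" for n
      using s by (auto simp: t_def IJ) (metis H(1) IJ imageE)+
    have "\<forall>e>0. \<exists>N. \<forall>m\<ge>N. \<forall>n\<ge>N. dst Z (t m) (t n) < e"
      using C t dst by simp
    moreover have "\<forall>n. t n \<in> ?V" using t WV by blast
    ultimately obtain l where l: "l \<in> ?V" "(\<lambda>n. dst Z (t n) l) \<longlonglongrightarrow> 0"
      using ban unfolding banach_space_def by blast
    have "l \<in> W"
    proof -
      have "p l w = 0" if w: "w \<in> ?V" "\<forall>x. p w (A x) = 0" for w
      proof -
        have "\<bar>p l w\<bar> \<le> dst Z (t n) l * nrm Z w" for n
        proof -
          have "p (add Z (t n) (scl Z (- 1) l)) w = p (t n) w - p l w"
            using pa ps t WV l w sc by simp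
          moreover have "p (t n) w = 0" using t w by (auto simp: W_def)
          moreover have "\<bar>p (add Z (t n) (scl Z (- 1) l)) w\<bar> \<le> dst Z (t n) l * nrm Z w"
            unfolding dst_def using cs t WV l w sc ac by blast
          ultimately show ?thesis by simp
        qed
        moreover have "(\<lambda>n. dst Z (t n) l * nrm Z w) \<longlonglongrightarrow> 0"
          using l(2) tendsto_mult_left_zero by blast
        ultimately have "\<bar>p l w\<bar> \<le> 0"
          by (meson LIMSEQ_le_const)
        then show ?thesis by simp
      qed
      then show ?thesis using l by (simp add: W_def)
    qed
    then show ?thesis using l t dst by auto
  qed
  have hil: "hilbert_space H"
    using rns comp ni unfolding hilbert_space_def banach_space_def by blast
  have "bounded_operator (induced UNIV) H (\<lambda>x. J (A x))"
    unfolding bounded_operator_def using AW Aa As Ja Js K by (auto simp: IJ)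
  moreover have "bounded_operator H (induced UNIV) (\<lambda>f. B (I f))"
    using B WV unfolding bounded_operator_def by (auto simp: IJ cla cls) blast
  moreover have "\<forall>x. T x = B (I (J (A x)))" using TBA AW IJ by simp
  ultimately have "factorizable_through T H"
    unfolding factorizable_through_def by blast
  then show ?thesis using hil unfolding factorizable_through_hilbert_def by blast
qed

end

theory Submission
  imports Defs
begin

text \<open>
  Everything rests on one construction. Let \<open>r\<close> be a continuous positive semidefinite symmetric
  bilinear form on \<open>X\<close>. The functionals \<open>f\<close> on \<open>X\<close> with \<open>\<bar>f y\<bar> \<le> C * sqrt (r y y)\<close> for some \<open>C\<close>, with the
  least \<open>C\<close> as norm, form a Hilbert space that embeds continuously in \<open>X*\<close>. It is a model, inside
  \<open>X*\<close>, of the completion of \<open>X\<close> modulo the kernel of \<open>r\<close>.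

  Call a symmetric operator \<open>T\<close> from \<open>X\<close> to \<open>X*\<close> controlled by \<open>r\<close> if
  \<open>\<bar>T x y\<bar> \<le> K * norm x * sqrt (r y y)\<close> for some \<open>K\<close>, that is, if \<open>T\<close> is bounded as a map into the dual
  Hilbert space of \<open>r\<close>. Control by some \<open>r\<close> is what links the two sides of (a), where \<open>T\<close> is the operator
  of the quadratic form \<open>q\<close>, that is, \<open>q x = T x x\<close>:

  \<^item> if \<open>q = q1 - q2\<close> with \<open>q1\<close>, \<open>q2\<close> semidefinite, then the form of \<open>q1 + q2\<close> controls \<open>T\<close>, by
    polarization (\<open>semi_inner_product_of_delta_semidefinite\<close>);
  \<^item> if \<open>r\<close> controls \<open>T\<close>, then \<open>T\<close> followed by the inclusion in \<open>X*\<close> factors \<open>T\<close> through the dual Hilbert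
    space (\<open>factorizable_through_dual\<close>);
  \<^item> if \<open>T = B A\<close> with \<open>A\<close> mapping to a Hilbert space, then \<open>\<langle>A x, A y\<rangle>\<close> controls \<open>T\<close>, because
    \<open>T x y = T y x = B (A y) x\<close> (\<open>delta_semidefinite_of_factorizable\<close>);
  \<^item> if \<open>r\<close> controls \<open>T\<close>, then \<open>2 * \<bar>T x x\<bar> \<le> r x x + \<parallel>T x\<parallel>\<^sup>2\<close> with the dual norm, and the right-hand
    side is a continuous quadratic form, so \<open>q\<close> is delta-semidefinite (\<open>dominating_form\<close>).

  For a quotient \<open>X/L\<close>, a form on \<open>X/L\<close> is lifted to \<open>X\<close>; the point is to choose a controlling form that
  is constant on cosets. If \<open>r\<close> controls \<open>T\<close>, then the inner product dual to \<open>r\<close>, pulled back along \<open>T\<close>,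
  is such a form (\<open>property_D_quotient\<close>). For a complemented subspace \<open>Y\<close>, a form on \<open>Y\<close> extends to \<open>X\<close> through the
  projection, and a decomposition on \<open>X\<close> restricts to \<open>Y\<close>.
\<close>

section \<open>Semi-inner products\<close>

text \<open>
  This is the discriminant criterion, stated as an upper bound for the linear term because all the
  inequalities below arise in that form. It serves the Cauchy--Schwarz inequality and its variants.
\<close>

lemma square_le_of_quadratic_nonneg:
  fixes a b g :: real
  assumes "\<And>t. 2 * t * g \<le> a + t\<^sup>2 * b" and "0 \<le> b"
  shows "g\<^sup>2 \<le> a * b"
proof (cases "b = 0")
  case True
  have "g = 0"
  proof (rule ccontr)
    assume "g \<noteq> 0"
    then have "2 * ((\<bar>a\<bar> + 1) / g) * g = 2 * (\<bar>a\<bar> + 1)" by simp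
    then show False using assms(1)[of "(\<bar>a\<bar> + 1) / g"] True by simp
  qed
  then show ?thesis using True by simp
next
  case False
  then have b: "b > 0" using assms(2) by simp
  \<comment> \<open>The difference of the two sides is minimal at \<open>t = g / b\<close>.\<close>
  have "2 * (g / b) * g \<le> a + (g / b)\<^sup>2 * b" by (rule assms(1))
  then have "g\<^sup>2 / b \<le> a" using b by (simp add: power2_eq_square field_simps)
  then show ?thesis using b by (simp add: field_simps)
qed

locale semi_inner_product =
  fixes r :: "'a::real_normed_vector \<Rightarrow> 'a \<Rightarrow> real"
  assumes bilinear: "bounded_bilinear r"
    and sym: "r x y = r y x"
    and nonneg: "0 \<le> r x x"
begin

sublocale bounded_bilinear r by (rule bilinear)

lemma form_on_line:
  "r (x + t *\<^sub>R y) (x + t *\<^sub>R y) = r x x + 2 * t * r x y + t\<^sup>2 * r y y"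
  by (simp add: add_left add_right scaleR_left scaleR_right sym[of y x] power2_eq_square algebra_simps)

lemma Cauchy_Schwarz: "\<bar>r x y\<bar> \<le> sqrt (r x x) * sqrt (r y y)"
proof -
  have "2 * t * r x y \<le> r x x + t\<^sup>2 * r y y" for t
    using nonneg[of "x + (- t) *\<^sub>R y"] unfolding form_on_line by simp
  then have "(r x y)\<^sup>2 \<le> r x x * r y y" using nonneg by (rule square_le_of_quadratic_nonneg)
  then show ?thesis by (metis real_sqrt_abs real_sqrt_le_mono real_sqrt_mult)
qed

lemma sqrt_bound: obtains M where "0 \<le> M" "\<And>x. sqrt (r x x) \<le> M * norm x"
proof -
  obtain K where K: "0 \<le> K" "\<And>x y. norm (r x y) \<le> norm x * norm y * K" using nonneg_bounded by blast
  have "sqrt (r x x) \<le> sqrt K * norm x" for x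
  proof -
    have "sqrt (r x x) \<le> sqrt (norm x * norm x * K)" using K(2)[of x x] by simp
    then show ?thesis by (simp add: real_sqrt_mult mult.commute)
  qed
  then show thesis using that[of "sqrt K"] K(1) by simp
qed

end

section \<open>The Hilbert space dual to a semi-inner product\<close>

context semi_inner_product
begin

definition bounds :: "('a \<Rightarrow>\<^sub>L real) \<Rightarrow> real set" where
  "bounds f = {C. 0 \<le> C \<and> (\<forall>y. \<bar>f y\<bar> \<le> C * sqrt (r y y))}"

definition dual_norm :: "('a \<Rightarrow>\<^sub>L real) \<Rightarrow> real" where
  "dual_norm f = Inf (bounds f)"

text \<open>
  The operations are those of \<open>X*\<close>; only the norm is new. A factorization through this space needs
  no second map other than the inclusion.
\<close>

definition dual :: "('a \<Rightarrow>\<^sub>L real) nspace" where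
  "dual = \<lparr>points = {f. bounds f \<noteq> {}}, zer = 0, add = (+), scl = (*\<^sub>R), nrm = dual_norm\<rparr>"

lemma dual_simps [simp]:
  "zer dual = 0" "add dual = (+)" "scl dual = (*\<^sub>R)" "nrm dual = dual_norm"
  by (simp_all add: dual_def)

lemma mem_dual: "f \<in> points dual \<longleftrightarrow> bounds f \<noteq> {}"
  by (simp add: dual_def)

lemma dual_norm_le: "C \<in> bounds f \<Longrightarrow> dual_norm f \<le> C"
  unfolding dual_norm_def by (rule cInf_lower) (auto simp: bounds_def intro!: bdd_belowI[of _ 0])

text \<open>The infimum is attained, because the conditions on \<open>C\<close> are non-strict inequalities.\<close>

lemma dual_norm_mem_bounds:
  assumes "f \<in> points dual"
  shows "dual_norm f \<in> bounds f"
proof -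
  have ne: "bounds f \<noteq> {}" using assms by (simp add: mem_dual)
  have "0 \<le> dual_norm f" unfolding dual_norm_def
    using ne by (rule cInf_greatest) (simp add: bounds_def)
  moreover have "\<bar>f y\<bar> \<le> dual_norm f * sqrt (r y y)" for y
  proof (cases "r y y = 0")
    case True
    obtain C where "C \<in> bounds f" using ne by blast
    then have "\<bar>f y\<bar> \<le> C * sqrt (r y y)" by (simp add: bounds_def)
    then show ?thesis by (simp add: True)
  next
    case False
    then have p: "sqrt (r y y) > 0" using nonneg[of y] by simp
    have "\<bar>f y\<bar> / sqrt (r y y) \<le> dual_norm f" unfolding dual_norm_def
      using ne by (rule cInf_greatest) (use p in \<open>auto simp: bounds_def divide_le_eq\<close>)
    then show ?thesis using p by (simp add: divide_le_eq)
  qed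
  ultimately show ?thesis by (simp add: bounds_def)
qed

lemma dual_norm_nonneg: "f \<in> points dual \<Longrightarrow> 0 \<le> dual_norm f"
  using dual_norm_mem_bounds by (auto simp: bounds_def)

lemma dual_norm_apply: "f \<in> points dual \<Longrightarrow> \<bar>f y\<bar> \<le> dual_norm f * sqrt (r y y)"
  using dual_norm_mem_bounds by (auto simp: bounds_def)

lemma bounds_add: "C \<in> bounds f \<Longrightarrow> D \<in> bounds g \<Longrightarrow> C + D \<in> bounds (f + g)"
  unfolding bounds_def
  by (auto simp: blinfun.add_left distrib_right) (meson abs_triangle_ineq add_mono order_trans)

lemma bounds_scale: "C \<in> bounds f \<Longrightarrow> \<bar>c\<bar> * C \<in> bounds (c *\<^sub>R f)"
  unfolding bounds_def by (auto simp: blinfun.scaleR_left abs_mult mult.assoc mult_left_mono)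

lemma zero_mem_bounds: "0 \<in> bounds 0"
  by (simp add: bounds_def)

lemma dual_closed:
  "0 \<in> points dual"
  "f \<in> points dual \<Longrightarrow> g \<in> points dual \<Longrightarrow> f + g \<in> points dual"
  "f \<in> points dual \<Longrightarrow> c *\<^sub>R f \<in> points dual"
  using zero_mem_bounds bounds_add bounds_scale unfolding mem_dual by fast+

lemma dual_closed_diff:
  "f \<in> points dual \<Longrightarrow> g \<in> points dual \<Longrightarrow> f - g \<in> points dual"
  using dual_closed(2)[of f "(-1) *\<^sub>R g"] dual_closed(3)[of g "-1"] by simp

lemma dual_norm_triangle:
  "f \<in> points dual \<Longrightarrow> g \<in> points dual \<Longrightarrow> dual_norm (f + g) \<le> dual_norm f + dual_norm g"
  by (intro dual_norm_le bounds_add dual_norm_mem_bounds)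

lemma dual_norm_scale:
  assumes f: "f \<in> points dual"
  shows "dual_norm (c *\<^sub>R f) = \<bar>c\<bar> * dual_norm f"
proof (rule antisym)
  have le: "dual_norm (d *\<^sub>R g) \<le> \<bar>d\<bar> * dual_norm g" if "g \<in> points dual" for d g
    using that by (intro dual_norm_le bounds_scale dual_norm_mem_bounds)
  show "dual_norm (c *\<^sub>R f) \<le> \<bar>c\<bar> * dual_norm f" using f by (rule le)
  show "\<bar>c\<bar> * dual_norm f \<le> dual_norm (c *\<^sub>R f)"
  proof (cases "c = 0")
    case True
    then show ?thesis using dual_norm_nonneg[OF dual_closed(1)] by simp
  next
    case False
    have "dual_norm f \<le> \<bar>inverse c\<bar> * dual_norm (c *\<^sub>R f)"
      using le[OF dual_closed(3)[OF f], of "inverse c" c] False by simp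
    then show ?thesis using False by (simp add: field_simps)
  qed
qed

lemma dual_norm_eq_0:
  assumes "f \<in> points dual"
  shows "dual_norm f = 0 \<longleftrightarrow> f = 0"
proof
  assume "dual_norm f = 0"
  then show "f = 0" using dual_norm_apply[OF assms] by (intro blinfun_eqI) simp
next
  assume "f = 0"
  then show "dual_norm f = 0"
    using dual_norm_le[OF zero_mem_bounds] dual_norm_nonneg[OF assms] by simp
qed

lemma real_normed_space_dual: "real_normed_space dual"
  unfolding real_normed_space_def real_vector_space_def
  using dual_closed dual_norm_nonneg dual_norm_eq_0 dual_norm_triangle dual_norm_scale
  by (auto simp: algebra_simps)

lemma norm_le_dual_norm:
  obtains M where "0 \<le> M" "\<And>f. f \<in> points dual \<Longrightarrow> norm f \<le> M * dual_norm f"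
proof -
  obtain M where M: "0 \<le> M" "\<And>x. sqrt (r x x) \<le> M * norm x" using sqrt_bound by blast
  have "norm f \<le> M * dual_norm f" if f: "f \<in> points dual" for f
  proof (rule norm_blinfun_bound)
    show "0 \<le> M * dual_norm f" using M(1) dual_norm_nonneg[OF f] by simp
    fix x
    have "\<bar>f x\<bar> \<le> dual_norm f * sqrt (r x x)" using f by (rule dual_norm_apply)
    also have "\<dots> \<le> dual_norm f * (M * norm x)"
      using M(2) dual_norm_nonneg[OF f] by (rule mult_left_mono)
    finally show "norm (f x) \<le> M * dual_norm f * norm x" by (simp add: mult_ac)
  qed
  then show thesis using that M(1) by blast
qed

text \<open>
  A Cauchy sequence for the dual norm converges in the norm of \<open>X*\<close>, hence pointwise; and the
  inequality that defines a bound passes to pointwise limits.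
\<close>

lemma banach_space_dual: "banach_space dual"
proof -
  have "\<exists>l\<in>points dual. (\<lambda>n. dst dual (s n) l) \<longlonglongrightarrow> 0"
    if s: "\<forall>n. s n \<in> points dual"
      and C: "\<forall>e>0. \<exists>N. \<forall>m\<ge>N. \<forall>n\<ge>N. dst dual (s m) (s n) < e" for s :: "nat \<Rightarrow> 'a \<Rightarrow>\<^sub>L real"
  proof -
    have dst: "dst dual f g = dual_norm (f - g)" for f g by (simp add: dst_def)
    obtain M where M: "0 \<le> M" "\<And>f. f \<in> points dual \<Longrightarrow> norm f \<le> M * dual_norm f"
      using norm_le_dual_norm by blast
    have "Cauchy s"
    proof (rule metric_CauchyI)
      fix e :: real assume "0 < e"
      then have "e / (M + 1) > 0" using M(1) by simp
      then obtain N where N: "\<forall>m\<ge>N. \<forall>n\<ge>N. dst dual (s m) (s n) < e / (M + 1)" using C by blast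
      have "dist (s m) (s n) < e" if "m \<ge> N" "n \<ge> N" for m n
      proof -
        have d: "s m - s n \<in> points dual" using s dual_closed_diff by blast
        have "dist (s m) (s n) \<le> M * dual_norm (s m - s n)" using M(2)[OF d] by (simp add: dist_norm)
        also have "\<dots> \<le> (M + 1) * dual_norm (s m - s n)"
          using dual_norm_nonneg[OF d] by (intro mult_right_mono) auto
        also have "\<dots> < e" using N that M(1) by (simp add: dst field_simps)
        finally show ?thesis .
      qed
      then show "\<exists>N. \<forall>m\<ge>N. \<forall>n\<ge>N. dist (s m) (s n) < e" by blast
    qed
    then obtain f where f: "s \<longlonglongrightarrow> f" using Cauchy_convergent convergentD by blast
    have bd: "\<exists>N. \<forall>n\<ge>N. e \<in> bounds (s n - f)" if "0 < e" for e
    proof -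
      obtain N where N: "\<forall>m\<ge>N. \<forall>n\<ge>N. dual_norm (s m - s n) < e" using C \<open>0 < e\<close> by (auto simp: dst)
      have "\<bar>(s n - f) y\<bar> \<le> e * sqrt (r y y)" if n: "n \<ge> N" for n y
      proof -
        have "(\<lambda>m. \<bar>(s n - s m) y\<bar>) \<longlonglongrightarrow> \<bar>(s n - f) y\<bar>"
          using f by (intro tendsto_intros)
        moreover have "\<bar>(s n - s m) y\<bar> \<le> e * sqrt (r y y)" if "m \<ge> N" for m
        proof -
          have "\<bar>(s n - s m) y\<bar> \<le> dual_norm (s n - s m) * sqrt (r y y)"
            using s dual_closed_diff dual_norm_apply by blast
          also have "\<dots> \<le> e * sqrt (r y y)"
            using N n that nonneg by (intro mult_right_mono) (auto intro: less_imp_le)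
          finally show ?thesis .
        qed
        ultimately show ?thesis by (meson LIMSEQ_le_const2)
      qed
      then show ?thesis using \<open>0 < e\<close> by (auto simp: bounds_def)
    qed
    obtain N where "1 \<in> bounds (s N - f)" using bd[of 1] by auto
    then have "s N - (s N - f) \<in> points dual" using s dual_closed_diff mem_dual by blast
    then have fd: "f \<in> points dual" by simp
    have "(\<lambda>n. dual_norm (s n - f)) \<longlonglongrightarrow> 0"
    proof (rule LIMSEQ_I)
      fix e :: real assume "0 < e"
      then obtain N where "\<forall>n\<ge>N. e / 2 \<in> bounds (s n - f)" using bd[of "e / 2"] by auto
      then have "\<forall>n\<ge>N. dual_norm (s n - f) < e"
        using dual_norm_le \<open>0 < e\<close> by (smt (verit) field_sum_of_halves)
      moreover have "\<forall>n. dual_norm (s n - f) \<ge> 0"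
        using s fd dual_closed_diff dual_norm_nonneg by blast
      ultimately show "\<exists>N. \<forall>n\<ge>N. norm (dual_norm (s n - f) - 0) < e" by auto
    qed
    then show ?thesis using fd by (auto simp: dst)
  qed
  then show ?thesis unfolding banach_space_def using real_normed_space_dual by blast
qed

lemma prod_right_dual: "prod_right x \<in> points dual"
  and dual_norm_prod_right: "dual_norm (prod_right x) = sqrt (r x x)"
proof -
  have m: "sqrt (r x x) \<in> bounds (prod_right x)"
    using nonneg Cauchy_Schwarz by (simp add: bounds_def prod_right.rep_eq)
  then show d: "prod_right x \<in> points dual" by (auto simp: mem_dual)
  have "sqrt (r x x) * sqrt (r x x) \<le> dual_norm (prod_right x) * sqrt (r x x)"
    using dual_norm_apply[OF d, of x] nonneg by (simp add: prod_right.rep_eq)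
  then have "sqrt (r x x) \<le> dual_norm (prod_right x)"
    using dual_norm_nonneg[OF d] nonneg[of x]
    by (metis less_eq_real_def mult_right_le_imp_le real_sqrt_gt_0_iff real_sqrt_zero)
  then show "dual_norm (prod_right x) = sqrt (r x x)" using dual_norm_le[OF m] by simp
qed

text \<open>
  This approximate form of the Riesz representation theorem needs no completeness. The functional
  \<open>x \<mapsto> 2 * f x - r x x\<close> is bounded above on \<open>X\<close>; at a point \<open>x\<close> where it comes within \<open>e\<^sup>2\<close> of its
  supremum, the variation along a line through \<open>x\<close> in direction \<open>y\<close> gives a quadratic inequality in the
  parameter, whose discriminant bounds \<open>f y - r x y\<close>.
\<close>

lemma prod_right_dense:
  assumes f: "f \<in> points dual" and e: "0 < e"
  shows "\<exists>x. dual_norm (f - prod_right x) \<le> e"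
proof -
  define S where "S = range (\<lambda>x. 2 * f x - r x x)"
  have "2 * f x - r x x \<le> (dual_norm f)\<^sup>2" for x
  proof -
    have "0 \<le> (dual_norm f - sqrt (r x x))\<^sup>2" by simp
    then show ?thesis
      using dual_norm_apply[OF f, of x] nonneg[of x] by (simp add: power2_diff)
  qed
  then have S: "bdd_above S" by (auto simp: S_def bdd_above_def)
  have "Sup S - e\<^sup>2 < Sup S" using e by simp
  then obtain x where x: "Sup S - e\<^sup>2 < 2 * f x - r x x"
    using less_cSup_iff[OF _ S, of "Sup S - e\<^sup>2"] unfolding S_def by blast
  have "\<bar>(f - prod_right x) y\<bar> \<le> e * sqrt (r y y)" for y
  proof -
    have "2 * t * (f y - r x y) \<le> e\<^sup>2 + t\<^sup>2 * r y y" for t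
    proof -
      have "2 * f (x + t *\<^sub>R y) - r (x + t *\<^sub>R y) (x + t *\<^sub>R y) \<le> Sup S"
        using S by (intro cSup_upper) (auto simp: S_def)
      then show ?thesis
        using x unfolding form_on_line by (simp add: blinfun.add_right blinfun.scaleR_right algebra_simps)
    qed
    then have "(f y - r x y)\<^sup>2 \<le> e\<^sup>2 * r y y" using nonneg by (rule square_le_of_quadratic_nonneg)
    then have "\<bar>f y - r x y\<bar> \<le> sqrt (e\<^sup>2 * r y y)" by (metis real_sqrt_abs real_sqrt_le_mono)
    then show ?thesis using e by (simp add: real_sqrt_mult blinfun.diff_left prod_right.rep_eq)
  qed
  then show ?thesis using e dual_norm_le[of e] by (auto simp: bounds_def)
qed

text \<open>
  The parallelogram law for the dual norm is obtained by approximation: the functionals \<open>r x\<close> satisfy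
  it, they are dense, and the norm is continuous. The inner product is thus a limit of values of \<open>r\<close>,
  from which it inherits bilinearity.
\<close>

definition approximates :: "(nat \<Rightarrow> 'a) \<Rightarrow> ('a \<Rightarrow>\<^sub>L real) \<Rightarrow> bool" where
  "approximates X f \<longleftrightarrow> (\<lambda>n. dual_norm (f - prod_right (X n))) \<longlonglongrightarrow> 0"

lemma approximates_exists:
  assumes "f \<in> points dual"
  obtains X where "approximates X f"
proof -
  have "\<forall>n. \<exists>x. dual_norm (f - prod_right x) \<le> 1 / Suc n"
    using prod_right_dense[OF assms] by (metis of_nat_0_less_iff zero_less_Suc zero_less_divide_1_iff)
  then obtain X where X: "\<And>n. dual_norm (f - prod_right (X n)) \<le> 1 / Suc n" by metis
  have "(\<lambda>n. dual_norm (f - prod_right (X n))) \<longlonglongrightarrow> 0"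
    using X dual_norm_nonneg[OF dual_closed_diff[OF assms prod_right_dual]]
    by (intro tendsto_sandwich[OF _ _ tendsto_const LIMSEQ_Suc[OF lim_1_over_n]]) auto
  then show thesis using that by (simp add: approximates_def)
qed

lemma approximates_combination:
  assumes f: "f \<in> points dual" "approximates X f" and g: "g \<in> points dual" "approximates Y g"
  shows "approximates (\<lambda>n. X n + c *\<^sub>R Y n) (f + c *\<^sub>R g)"
proof -
  have "(\<lambda>n. dual_norm (f - prod_right (X n)) + \<bar>c\<bar> * dual_norm (g - prod_right (Y n))) \<longlonglongrightarrow> 0 + \<bar>c\<bar> * 0"
    using f g unfolding approximates_def by (intro tendsto_intros)
  then have lim: "(\<lambda>n. dual_norm (f - prod_right (X n)) + \<bar>c\<bar> * dual_norm (g - prod_right (Y n))) \<longlonglongrightarrow> 0"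
    by simp
  have eq: "f + c *\<^sub>R g - prod_right (X n + c *\<^sub>R Y n)
      = (f - prod_right (X n)) + c *\<^sub>R (g - prod_right (Y n))" for n
    by (rule blinfun_eqI)
      (simp add: prod_right.rep_eq blinfun.add_left blinfun.diff_left blinfun.scaleR_left
        add_left scaleR_left algebra_simps)
  have d: "f - prod_right (X n) \<in> points dual" "g - prod_right (Y n) \<in> points dual" for n
    using f g dual_closed_diff prod_right_dual by blast+
  have "dual_norm (f + c *\<^sub>R g - prod_right (X n + c *\<^sub>R Y n))
      \<le> dual_norm (f - prod_right (X n)) + \<bar>c\<bar> * dual_norm (g - prod_right (Y n))" for n
    unfolding eq using dual_norm_triangle[OF d(1) dual_closed(3)[OF d(2)]] dual_norm_scale[OF d(2)] by metis
  moreover have "0 \<le> dual_norm (f + c *\<^sub>R g - prod_right (X n + c *\<^sub>R Y n))" for n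
    unfolding eq using d dual_closed dual_norm_nonneg by blast
  ultimately show ?thesis unfolding approximates_def
    by (intro tendsto_sandwich[OF _ _ tendsto_const lim]) auto
qed

lemma approximates_norm:
  assumes f: "f \<in> points dual" and X: "approximates X f"
  shows "(\<lambda>n. r (X n) (X n)) \<longlonglongrightarrow> (dual_norm f)\<^sup>2"
proof -
  have "\<bar>sqrt (r (X n) (X n)) - dual_norm f\<bar> \<le> dual_norm (f - prod_right (X n))" for n
  proof -
    let ?R = "prod_right (X n)"
    have R: "?R \<in> points dual" by (rule prod_right_dual)
    have d: "f - ?R \<in> points dual" using f R by (rule dual_closed_diff)
    have "dual_norm f \<le> dual_norm (f - ?R) + dual_norm ?R"
      using dual_norm_triangle[OF d R] by simp
    moreover have "dual_norm ?R \<le> dual_norm f + dual_norm (f - ?R)"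
      using dual_norm_triangle[OF f dual_closed(3)[OF d], of "-1"] dual_norm_scale[OF d, of "-1"] by simp
    ultimately show ?thesis by (simp add: dual_norm_prod_right)
  qed
  then have "\<forall>\<^sub>F n in sequentially. norm (sqrt (r (X n) (X n)) - dual_norm f)
      \<le> dual_norm (f - prod_right (X n))"
    by simp
  then have "(\<lambda>n. sqrt (r (X n) (X n)) - dual_norm f) \<longlonglongrightarrow> 0"
    using X unfolding approximates_def by (rule Lim_null_comparison)
  then have "(\<lambda>n. sqrt (r (X n) (X n))) \<longlonglongrightarrow> dual_norm f" by (rule LIM_zero_cancel)
  then have "(\<lambda>n. (sqrt (r (X n) (X n)))\<^sup>2) \<longlonglongrightarrow> (dual_norm f)\<^sup>2" by (rule tendsto_power)
  then show ?thesis using nonneg by simp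
qed

definition dual_inner :: "('a \<Rightarrow>\<^sub>L real) \<Rightarrow> ('a \<Rightarrow>\<^sub>L real) \<Rightarrow> real" where
  "dual_inner f g = ((dual_norm (f + g))\<^sup>2 - (dual_norm (f - g))\<^sup>2) / 4"

lemma dual_inner_limit:
  assumes f: "f \<in> points dual" "approximates X f" and g: "g \<in> points dual" "approximates Y g"
  shows "(\<lambda>n. r (X n) (Y n)) \<longlonglongrightarrow> dual_inner f g"
proof -
  have lim: "(\<lambda>n. r (X n + c *\<^sub>R Y n) (X n + c *\<^sub>R Y n)) \<longlonglongrightarrow> (dual_norm (f + c *\<^sub>R g))\<^sup>2" for c
    using f g dual_closed approximates_combination by (intro approximates_norm) auto
  have "(\<lambda>n. (r (X n + 1 *\<^sub>R Y n) (X n + 1 *\<^sub>R Y n) - r (X n + (-1) *\<^sub>R Y n) (X n + (-1) *\<^sub>R Y n)) / 4)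
      \<longlonglongrightarrow> ((dual_norm (f + 1 *\<^sub>R g))\<^sup>2 - (dual_norm (f + (-1) *\<^sub>R g))\<^sup>2) / 4"
    by (intro tendsto_intros lim) simp
  then show ?thesis unfolding form_on_line by (simp add: dual_inner_def)
qed

lemma norm_inner_dual: "norm_inner dual dual_inner"
proof -
  have add: "dual_inner (f + c *\<^sub>R g) h = dual_inner f h + c * dual_inner g h"
    if f: "f \<in> points dual" and g: "g \<in> points dual" and h: "h \<in> points dual" for f g h c
  proof -
    obtain X Y Z where XYZ: "approximates X f" "approximates Y g" "approximates Z h"
      using approximates_exists f g h by metis
    have "(\<lambda>n. r (X n + c *\<^sub>R Y n) (Z n)) \<longlonglongrightarrow> dual_inner (f + c *\<^sub>R g) h"
      using f g h XYZ dual_closed approximates_combination by (intro dual_inner_limit) auto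
    moreover have "(\<lambda>n. r (X n) (Z n) + c * r (Y n) (Z n)) \<longlonglongrightarrow> dual_inner f h + c * dual_inner g h"
      using f g h XYZ by (intro tendsto_intros dual_inner_limit)
    ultimately show ?thesis
      by (intro LIMSEQ_unique) (simp_all add: add_left scaleR_left)
  qed
  have sym: "dual_inner f g = dual_inner g f" if f: "f \<in> points dual" and g: "g \<in> points dual" for f g
    using dual_norm_scale[OF dual_closed_diff[OF f g], of "-1"] by (simp add: dual_inner_def add.commute)
  have sq: "dual_inner f f = (dual_norm f)\<^sup>2" if f: "f \<in> points dual" for f
    using dual_norm_scale[OF f, of 2] dual_norm_eq_0[OF dual_closed(1)]
    by (simp add: dual_inner_def scaleR_2 power_mult_distrib)
  have zero: "dual_inner 0 h = 0" if "h \<in> points dual" for h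
    using add[OF dual_closed(1) dual_closed(1) that, of 1] by simp
  show ?thesis unfolding norm_inner_def
    using sym sq add[where c = 1] add[OF dual_closed(1)] zero by auto
qed

lemma hilbert_space_dual: "hilbert_space dual"
  using banach_space_dual norm_inner_dual unfolding hilbert_space_def by blast

lemma bounded_operator_into_dual:
  fixes T :: "'a \<Rightarrow>\<^sub>L ('a \<Rightarrow>\<^sub>L real)"
  assumes "\<And>x y. \<bar>T x y\<bar> \<le> K * norm x * sqrt (r y y)"
  shows "bounded_operator (induced UNIV) dual T"
proof -
  have b: "\<bar>K\<bar> * norm x \<in> bounds (T x)" for x
  proof -
    have "\<bar>T x y\<bar> \<le> \<bar>K\<bar> * norm x * sqrt (r y y)" for y
      by (rule order_trans[OF assms]) (intro mult_right_mono, use nonneg in auto)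
    then show ?thesis by (simp add: bounds_def)
  qed
  then have "T x \<in> points dual" for x by (auto simp: mem_dual)
  moreover have "\<exists>K. \<forall>x. dual_norm (T x) \<le> K * norm x" using b dual_norm_le by blast
  ultimately show ?thesis
    unfolding bounded_operator_def by (simp add: blinfun.add_right blinfun.scaleR_right)
qed

lemma factorizable_through_dual:
  fixes T :: "'a \<Rightarrow>\<^sub>L ('a \<Rightarrow>\<^sub>L real)"
  assumes "\<And>x y. \<bar>T x y\<bar> \<le> K * norm x * sqrt (r y y)"
  shows "factorizable_through T dual"
proof -
  have "bounded_operator dual (induced UNIV) (\<lambda>f. f)"
    using norm_le_dual_norm unfolding bounded_operator_def by simp metis
  then show ?thesis
    unfolding factorizable_through_def using bounded_operator_into_dual[OF assms] by blast
qed

end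

section \<open>Controlled operators\<close>

lemma semi_inner_product_pullback:
  fixes A :: "'a::real_normed_vector \<Rightarrow> 'v"
  assumes V: "real_normed_space V" and p: "norm_inner V p"
    and A: "bounded_operator (induced UNIV) V A"
  shows "semi_inner_product (\<lambda>x y. p (A x) (A y))"
proof -
  have AV: "\<And>x. A x \<in> points V" and Aa: "\<And>x y. A (x + y) = add V (A x) (A y)"
    and As: "\<And>c x. A (c *\<^sub>R x) = scl V c (A x)"
    using A by (auto simp: bounded_operator_def)
  obtain K where K: "\<And>x. nrm V (A x) \<le> K * norm x"
    using A by (auto simp: bounded_operator_def)
  have nn: "\<And>z. z \<in> points V \<Longrightarrow> nrm V z \<ge> 0"
    and cl: "\<And>c z. z \<in> points V \<Longrightarrow> scl V c z \<in> points V"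
    "\<And>z w. z \<in> points V \<Longrightarrow> w \<in> points V \<Longrightarrow> add V z w \<in> points V"
    using V by (auto simp: real_normed_space_def real_vector_space_def)
  have sym: "\<And>z w. z \<in> points V \<Longrightarrow> w \<in> points V \<Longrightarrow> p z w = p w z"
    and pa: "\<And>u z w. u \<in> points V \<Longrightarrow> z \<in> points V \<Longrightarrow> w \<in> points V \<Longrightarrow> p (add V u z) w = p u w + p z w"
    and ps: "\<And>c z w. z \<in> points V \<Longrightarrow> w \<in> points V \<Longrightarrow> p (scl V c z) w = c * p z w"
    and pp: "\<And>z. z \<in> points V \<Longrightarrow> p z z = (nrm V z)\<^sup>2"
    using p by (auto simp: norm_inner_def)
  have add: "p (A (x + y)) (A z) = p (A x) (A z) + p (A y) (A z)" for x y z
    using Aa AV pa by simp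
  have scale: "p (A (c *\<^sub>R x)) (A z) = c * p (A x) (A z)" for c x z
    using As AV ps by simp
  have S: "p (A x) (A y) = p (A y) (A x)" for x y using AV sym by blast
  have "\<bar>p (A x) (A y)\<bar> \<le> norm x * norm y * K\<^sup>2" for x y
  proof -
    have "\<bar>p (A x) (A y)\<bar> \<le> nrm V (A x) * nrm V (A y)"
      using norm_inner_Cauchy_Schwarz[OF V p] AV by blast
    also have "\<dots> \<le> (K * norm x) * (K * norm y)"
      using K nn AV by (intro mult_mono) (auto intro: order_trans)
    finally show ?thesis by (simp add: power2_eq_square mult_ac)
  qed
  then have "bounded_bilinear (\<lambda>x y. p (A x) (A y))"
    using add scale S by unfold_locales (auto simp: intro!: exI[of _ "K\<^sup>2"])
  then show ?thesis
    using S pp AV by (simp add: semi_inner_product_def)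
qed

text \<open>
  Polarization writes \<open>4 * t * T x y\<close> as a difference of two values of \<open>q1 - q2\<close>, which is at most the sum of
  the same values of \<open>q1 + q2\<close>; the parallelogram law for \<open>q1 + q2\<close> then gives a quadratic inequality
  in \<open>t\<close>.
\<close>

lemma semi_inner_product_of_delta_semidefinite:
  fixes T :: "'a::real_normed_vector \<Rightarrow>\<^sub>L ('a \<Rightarrow>\<^sub>L real)"
  assumes T: "symmetric_operator T" and D: "delta_semidefinite (induced UNIV) (\<lambda>x. T x x)"
  obtains r K where "semi_inner_product r" "\<And>x y. \<bar>T x y\<bar> \<le> K * norm x * sqrt (r y y)"
proof -
  obtain q1 q2 where q: "continuous_quadratic_form (induced UNIV) q1" "\<And>x. q1 x \<ge> 0"
    "continuous_quadratic_form (induced UNIV) q2" "\<And>x. q2 x \<ge> 0" "\<And>x. T x x = q1 x - q2 x"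
    using D by (auto simp: delta_semidefinite_def)
  obtain b1 b2 where b: "bounded_bilinear b1" "bounded_bilinear b2"
    and qb: "\<And>x. q1 x = b1 x x" "\<And>x. q2 x = b2 x x"
    using q by (auto simp: continuous_quadratic_form_def continuous_bilinear_form_UNIV)
  interpret b1: bounded_bilinear b1 by (rule b)
  interpret b2: bounded_bilinear b2 by (rule b)
  define r where "r x y = (b1 x y + b1 y x + b2 x y + b2 y x) / 2" for x y
  have rq: "r x x = q1 x + q2 x" for x by (simp add: r_def qb)
  have "bounded_bilinear r"
  proof -
    obtain K1 K2 where K1: "\<And>x y. norm (b1 x y) \<le> norm x * norm y * K1"
      and K2: "\<And>x y. norm (b2 x y) \<le> norm x * norm y * K2"
      using b1.bounded b2.bounded by blast
    have "norm (r x y) \<le> norm x * norm y * (K1 + K2)" for x y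
      using K1[of x y] K1[of y x] K2[of x y] K2[of y x]
      by (simp add: r_def algebra_simps)
    then have "\<exists>K. \<forall>x y. norm (r x y) \<le> norm x * norm y * K" by blast
    then show ?thesis
      by (rule bounded_bilinear.intro[rotated -1])
        (simp_all add: r_def b1.add_left b1.add_right b2.add_left b2.add_right b1.scaleR_left
          b1.scaleR_right b2.scaleR_left b2.scaleR_right field_simps)
  qed
  then have r: "semi_inner_product r"
    using rq q by (simp add: semi_inner_product_def) (simp add: r_def add_ac)
  interpret semi_inner_product r by (rule r)
  obtain M where M: "0 \<le> M" "\<And>x. sqrt (r x x) \<le> M * norm x" using sqrt_bound by blast
  have "\<bar>T x y\<bar> \<le> M * norm x * sqrt (r y y)" for x y
  proof -
    have "2 * t * T x y \<le> r x x + t\<^sup>2 * r y y" for t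
    proof -
      have "T y x = T x y" using T by (simp add: symmetric_operator_def)
      then have "4 * t * T x y = T (x + t *\<^sub>R y) (x + t *\<^sub>R y) - T (x + (-t) *\<^sub>R y) (x + (-t) *\<^sub>R y)"
        by (simp add: blinfun.add_left blinfun.add_right blinfun.scaleR_left blinfun.scaleR_right
            blinfun.diff_left blinfun.diff_right algebra_simps)
      also have "\<dots> \<le> r (x + t *\<^sub>R y) (x + t *\<^sub>R y) + r (x + (-t) *\<^sub>R y) (x + (-t) *\<^sub>R y)"
        unfolding rq q(5) using q(2)[of "x + (-t) *\<^sub>R y"] q(4)[of "x + t *\<^sub>R y"] by simp
      finally have "2 * (2 * t * T x y) \<le> 2 * (r x x + t\<^sup>2 * r y y)"
        unfolding form_on_line by (simp add: algebra_simps)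
      then show ?thesis by (rule mult_left_le_imp_le) simp
    qed
    then have "(T x y)\<^sup>2 \<le> r x x * r y y" using nonneg by (rule square_le_of_quadratic_nonneg)
    then have "\<bar>T x y\<bar> \<le> sqrt (r x x) * sqrt (r y y)"
      by (metis real_sqrt_abs real_sqrt_le_mono real_sqrt_mult)
    also have "\<dots> \<le> M * norm x * sqrt (r y y)" using M(2) nonneg by (intro mult_right_mono) auto
    finally show ?thesis .
  qed
  then show thesis using that r by blast
qed

text \<open>The decomposition is \<open>q x = b x x - (b x x - q x)\<close>.\<close>

lemma delta_semidefiniteI:
  assumes q: "continuous_quadratic_form V q" and b: "continuous_bilinear_form V b"
    and le: "\<And>x. x \<in> points V \<Longrightarrow> \<bar>q x\<bar> \<le> b x x"
  shows "delta_semidefinite V q"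
proof -
  obtain c where c: "continuous_bilinear_form V c" "\<And>x. x \<in> points V \<Longrightarrow> q x = c x x"
    using q by (auto simp: continuous_quadratic_form_def)
  obtain K1 K2 where
    "\<And>x y. x \<in> points V \<Longrightarrow> y \<in> points V \<Longrightarrow> \<bar>b x y\<bar> \<le> nrm V x * nrm V y * K1"
    "\<And>x y. x \<in> points V \<Longrightarrow> y \<in> points V \<Longrightarrow> \<bar>c x y\<bar> \<le> nrm V x * nrm V y * K2"
    using b c(1) unfolding continuous_bilinear_form_def by metis
  then have "\<bar>b x y - c x y\<bar> \<le> nrm V x * nrm V y * (K1 + K2)"
    if "x \<in> points V" "y \<in> points V" for x y
    using that by (fastforce simp: distrib_left)
  then have "continuous_bilinear_form V (\<lambda>x y. b x y - c x y)"
    using b c(1) unfolding continuous_bilinear_form_def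
    by (intro conjI) (simp add: algebra_simps, simp add: algebra_simps, blast)
  then have "continuous_quadratic_form V (\<lambda>x. b x x - q x)"
    using c(2) by (auto simp: continuous_quadratic_form_def)
  moreover have "continuous_quadratic_form V (\<lambda>x. b x x)"
    using b by (auto simp: continuous_quadratic_form_def)
  moreover have "b x x - q x \<ge> 0" "b x x \<ge> 0" if "x \<in> points V" for x
    using le[OF that] by auto
  ultimately show ?thesis unfolding delta_semidefinite_def
    by (intro exI[of _ "\<lambda>x. b x x"] exI[of _ "\<lambda>x. b x x - q x"]) auto
qed

text \<open>
  By definition of the dual norm, \<open>\<bar>T x x\<bar>\<close> is at most \<open>\<parallel>T x\<parallel> * sqrt (r x x)\<close>; the arithmetic mean of the
  two squares is at least this product and, unlike it, is a quadratic form in \<open>x\<close>. The form \<open>b\<close>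
  depends on \<open>x\<close> and \<open>y\<close> only through \<open>r\<close> and \<open>T\<close>, which is what lets it descend to quotients.
\<close>

lemma dominating_form:
  fixes T :: "'a::real_normed_vector \<Rightarrow>\<^sub>L ('a \<Rightarrow>\<^sub>L real)"
  assumes r: "semi_inner_product r" and T: "\<And>x y. \<bar>T x y\<bar> \<le> K * norm x * sqrt (r y y)"
  defines "b \<equiv> \<lambda>x y. (r x y + semi_inner_product.dual_inner r (T x) (T y)) / 2"
  shows "bounded_bilinear b" and "\<bar>T x x\<bar> \<le> b x x"
proof -
  interpret semi_inner_product r by (rule r)
  have A: "bounded_operator (induced UNIV) dual T" using T by (rule bounded_operator_into_dual)
  interpret D: semi_inner_product "\<lambda>x y. dual_inner (T x) (T y)"
    using semi_inner_product_pullback[OF real_normed_space_dual norm_inner_dual A] .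
  obtain K1 K2 where K1: "\<And>x y. norm (r x y) \<le> norm x * norm y * K1"
    and K2: "\<And>x y. norm (dual_inner (T x) (T y)) \<le> norm x * norm y * K2"
    using bounded D.bounded by blast
  have "norm (b x y) \<le> norm x * norm y * ((K1 + K2) / 2)" for x y
    using K1[of x y] K2[of x y] by (simp add: b_def algebra_simps)
  then have "\<exists>K. \<forall>x y. norm (b x y) \<le> norm x * norm y * K" by blast
  then show "bounded_bilinear b"
    by (rule bounded_bilinear.intro[rotated -1])
      (simp_all add: b_def add_left add_right scaleR_left scaleR_right
        D.add_left D.add_right D.scaleR_left D.scaleR_right field_simps)
  have Tx: "T x \<in> points dual" using A by (simp add: bounded_operator_def)
  have "0 \<le> (dual_norm (T x) - sqrt (r x x))\<^sup>2" by simp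
  then have "2 * (dual_norm (T x) * sqrt (r x x)) \<le> (dual_norm (T x))\<^sup>2 + r x x"
    using nonneg[of x] by (simp add: power2_diff)
  moreover have "dual_inner (T x) (T x) = (dual_norm (T x))\<^sup>2"
    using norm_inner_dual Tx by (simp add: norm_inner_def)
  ultimately show "\<bar>T x x\<bar> \<le> b x x"
    using dual_norm_apply[OF Tx, of x] by (simp add: b_def)
qed

section \<open>Property (D) and factorization\<close>

lemma symmetric_operator_of_quadratic_form:
  fixes q :: "'a::real_normed_vector \<Rightarrow> real"
  assumes b: "bounded_bilinear b" and q: "\<And>x. q x = b x x"
  obtains T :: "'a \<Rightarrow>\<^sub>L ('a \<Rightarrow>\<^sub>L real)"
  where "symmetric_operator T" "\<And>x. T x x = q x" "\<And>x y. T x y = (b x y + b y x) / 2"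
proof -
  interpret b: bounded_bilinear b by (rule b)
  interpret f: bounded_bilinear "\<lambda>x y. b y x" by (rule b.flip)
  define T where "T = (1/2) *\<^sub>R (Blinfun b.prod_right + Blinfun f.prod_right)"
  have "T x y = (b x y + b y x) / 2" for x y
    by (simp add: T_def blinfun.add_left blinfun.scaleR_left b.prod_right.rep_eq f.prod_right.rep_eq
        bounded_linear_Blinfun_apply b.bounded_linear_prod_right f.bounded_linear_prod_right)
  then show thesis using that[of T] q by (simp add: symmetric_operator_def add.commute)
qed

lemma continuous_quadratic_form_operator:
  fixes T :: "'a::real_normed_vector \<Rightarrow>\<^sub>L ('a \<Rightarrow>\<^sub>L real)"
  shows "continuous_quadratic_form (induced UNIV) (\<lambda>x. T x x)"
proof -
  have "bounded_bilinear (\<lambda>x y. T x y)"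
  proof 
    show "\<exists>K. \<forall>a b. norm (T a b) \<le> norm a * norm b * K"
    proof (intro exI allI)
      fix a b
      have "norm (T a b) \<le> norm (T a) * norm b" by (rule norm_blinfun)
      also have "\<dots> \<le> norm T * norm a * norm b" by (intro mult_right_mono norm_blinfun) simp
      finally show "norm (T a b) \<le> norm a * norm b * norm T" by (simp add: mult_ac)
    qed
  qed (simp_all add: blinfun.add_left blinfun.add_right blinfun.scaleR_left blinfun.scaleR_right)
  then show ?thesis
    by (auto simp: continuous_quadratic_form_def continuous_bilinear_form_UNIV)
qed

text \<open>
  A factorization \<open>T = B A\<close> bounds \<open>T x\<close> in terms of \<open>A x\<close>, whereas a bound of the functional \<open>T x\<close> at \<open>y\<close>
  in terms of \<open>A y\<close> is needed; symmetry of \<open>T\<close> exchanges the two. In this way the adjoint of \<open>B\<close> and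
  the Riesz theorem in the given Hilbert space are avoided.
\<close>

lemma delta_semidefinite_of_factorizable:
  fixes T :: "'a::real_normed_vector \<Rightarrow>\<^sub>L ('a \<Rightarrow>\<^sub>L real)"
  assumes sym: "symmetric_operator T" and T: "factorizable_through_hilbert T"
  shows "delta_semidefinite (induced UNIV) (\<lambda>x. T x x)"
proof -
  obtain Z :: "('a \<Rightarrow>\<^sub>L real) nspace" and A B p
    where Z: "real_normed_space Z" and p: "norm_inner Z p"
      and A: "bounded_operator (induced UNIV) Z A" and B: "bounded_operator Z (induced UNIV) B"
      and TBA: "\<And>x. T x = B (A x)"
    using T by (auto simp: factorizable_through_hilbert_def factorizable_through_def
        hilbert_space_def banach_space_def)
  let ?r = "\<lambda>x y. p (A x) (A y)"
  have r: "semi_inner_product ?r" using semi_inner_product_pullback[OF Z p A] .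
  obtain K where K: "\<And>z. z \<in> points Z \<Longrightarrow> norm (B z) \<le> K * nrm Z z"
    using B unfolding bounded_operator_def induced_simps by blast
  have AZ: "\<And>x. A x \<in> points Z" using A by (auto simp: bounded_operator_def)
  have "\<bar>T x y\<bar> \<le> K * norm x * sqrt (?r y y)" for x y
  proof -
    have "\<bar>T x y\<bar> = \<bar>T y x\<bar>" using sym by (simp add: symmetric_operator_def)
    also have "\<dots> \<le> norm (B (A y)) * norm x" using norm_blinfun[of "T y" x] by (simp add: TBA)
    also have "\<dots> \<le> K * nrm Z (A y) * norm x" using K AZ by (intro mult_right_mono) auto
    also have "nrm Z (A y) = sqrt (?r y y)"
      using p AZ Z by (simp add: norm_inner_def real_normed_space_def)
    finally show ?thesis by (simp add: mult_ac)
  qed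
  note dominating = dominating_form[OF r this]
  show ?thesis
    using continuous_quadratic_form_operator dominating(1)[folded continuous_bilinear_form_UNIV]
      dominating(2) by (rule delta_semidefiniteI)
qed

lemma property_D_iff_factorizable:
  "property_D (induced (UNIV :: 'a::real_normed_vector set)) \<longleftrightarrow>
     (\<forall>T :: 'a \<Rightarrow>\<^sub>L ('a \<Rightarrow>\<^sub>L real). symmetric_operator T \<longrightarrow> factorizable_through_hilbert T)"
proof (intro iffI allI impI)
  fix T :: "'a \<Rightarrow>\<^sub>L ('a \<Rightarrow>\<^sub>L real)"
  assume D: "property_D (induced (UNIV :: 'a set))" and T: "symmetric_operator T"
  have "delta_semidefinite (induced UNIV) (\<lambda>x. T x x)"
    using D continuous_quadratic_form_operator by (auto simp: property_D_def)
  then obtain r K where "semi_inner_product r" "\<And>x y. \<bar>T x y\<bar> \<le> K * norm x * sqrt (r y y)"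
    using semi_inner_product_of_delta_semidefinite[OF T] by blast
  then show "factorizable_through_hilbert T"
    unfolding factorizable_through_hilbert_def
    using semi_inner_product.hilbert_space_dual semi_inner_product.factorizable_through_dual by blast
next
  assume F: "\<forall>T :: 'a \<Rightarrow>\<^sub>L ('a \<Rightarrow>\<^sub>L real). symmetric_operator T \<longrightarrow> factorizable_through_hilbert T"
  show "property_D (induced (UNIV :: 'a set))" unfolding property_D_def
  proof (intro allI impI)
    fix q :: "'a \<Rightarrow> real" assume "continuous_quadratic_form (induced UNIV) q"
    then obtain b where "bounded_bilinear b" "\<And>x. q x = b x x"
      by (auto simp: continuous_quadratic_form_def continuous_bilinear_form_UNIV)
    then obtain T :: "'a \<Rightarrow>\<^sub>L ('a \<Rightarrow>\<^sub>L real)"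
      where T: "symmetric_operator T" "\<And>x. T x x = q x"
      using symmetric_operator_of_quadratic_form by metis
    then have "delta_semidefinite (induced UNIV) (\<lambda>x. T x x)"
      using F delta_semidefinite_of_factorizable by blast
    then show "delta_semidefinite (induced UNIV) q" by (simp add: T(2))
  qed
qed

section \<open>Complemented subspaces and quotients\<close>

lemma continuous_bilinear_form_pullback:
  assumes b: "continuous_bilinear_form V b" and V: "\<And>x. x \<in> points V \<Longrightarrow> 0 \<le> nrm V x"
    and f: "bounded_operator W V f"
  shows "continuous_bilinear_form W (\<lambda>x y. b (f x) (f y))"
proof -
  have fV: "\<And>x. x \<in> points W \<Longrightarrow> f x \<in> points V"
    and fa: "\<And>x y. x \<in> points W \<Longrightarrow> y \<in> points W \<Longrightarrow> f (add W x y) = add V (f x) (f y)"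
    and fs: "\<And>c x. x \<in> points W \<Longrightarrow> f (scl W c x) = scl V c (f x)"
    using f by (auto simp: bounded_operator_def)
  obtain K where K: "\<And>x. x \<in> points W \<Longrightarrow> nrm V (f x) \<le> K * nrm W x"
    using f unfolding bounded_operator_def by blast
  obtain M where M: "\<And>x y. x \<in> points V \<Longrightarrow> y \<in> points V \<Longrightarrow> \<bar>b x y\<bar> \<le> nrm V x * nrm V y * M"
    using b unfolding continuous_bilinear_form_def by blast
  have "\<bar>b (f x) (f y)\<bar> \<le> nrm W x * nrm W y * (K * K * \<bar>M\<bar>)" if x: "x \<in> points W" and y: "y \<in> points W" for x y
  proof -
    have "\<bar>b (f x) (f y)\<bar> \<le> nrm V (f x) * nrm V (f y) * M" using M fV x y by blast
    also have "\<dots> \<le> nrm V (f x) * nrm V (f y) * \<bar>M\<bar>"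
      using V fV x y by (intro mult_left_mono mult_nonneg_nonneg) auto
    also have "\<dots> \<le> (K * nrm W x) * (K * nrm W y) * \<bar>M\<bar>"
      using K V fV x y by (intro mult_right_mono mult_mono) (auto intro: order_trans)
    finally show ?thesis by (simp add: mult_ac)
  qed
  then show ?thesis using b fV fa fs unfolding continuous_bilinear_form_def by auto
qed

lemma property_D_complemented:
  fixes Y :: "'a::real_normed_vector set"
  assumes D: "property_D (induced (UNIV :: 'a set))" and Y: "complemented_subspace Y"
  shows "property_D (induced Y)"
  unfolding property_D_def
proof (intro allI impI)
  fix q assume q: "continuous_quadratic_form (induced Y) q"
  then obtain b where b: "continuous_bilinear_form (induced Y) b" and qb: "\<And>x. x \<in> Y \<Longrightarrow> q x = b x x"
    by (auto simp: continuous_quadratic_form_def)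
  obtain P :: "'a \<Rightarrow>\<^sub>L 'a" where P: "range (blinfun_apply P) = Y" "\<And>y. y \<in> Y \<Longrightarrow> P y = y"
    using Y by (auto simp: complemented_subspace_def)
  have P': "bounded_operator (induced UNIV) (induced Y) P"
    using P(1) norm_blinfun by (auto simp: bounded_operator_def blinfun.add_right blinfun.scaleR_right)
  have "continuous_bilinear_form (induced UNIV) (\<lambda>x y. b (P x) (P y))"
    using continuous_bilinear_form_pullback[OF b _ P'] by simp
  then have "continuous_quadratic_form (induced UNIV) (\<lambda>x. b (P x) (P x))"
    by (auto simp: continuous_quadratic_form_def)
  then have "delta_semidefinite (induced UNIV) (\<lambda>x. b (P x) (P x))"
    using D by (simp add: property_D_def)
  then obtain q1 q2 where q12: "continuous_quadratic_form (induced UNIV) q1" "\<And>x. q1 x \<ge> 0"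
    "continuous_quadratic_form (induced UNIV) q2" "\<And>x. q2 x \<ge> 0" "\<And>x. b (P x) (P x) = q1 x - q2 x"
    by (auto simp: delta_semidefinite_def)
  have restrict: "continuous_quadratic_form (induced Y) q'" if "continuous_quadratic_form (induced UNIV) q'" for q'
    using that unfolding continuous_quadratic_form_def continuous_bilinear_form_def
    by simp blast
  have "q x = q1 x - q2 x" if "x \<in> Y" for x using q12(5)[of x] P(2) qb that by simp
  then show "delta_semidefinite (induced Y) q"
    unfolding delta_semidefinite_def induced_simps
    using restrict[OF q12(1)] restrict[OF q12(3)] q12(2,4) by blast
qed

lemma le_infdist_times:
  assumes "\<And>l. l \<in> L \<Longrightarrow> a \<le> dist x l * C" and "0 \<le> C" and "L \<noteq> {}"
  shows "a \<le> infdist x L * C"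
proof (cases "C = 0")
  case True
  then show ?thesis using assms by auto
next
  case False
  then have C: "C > 0" using assms(2) by simp
  have "a / C \<le> infdist x L"
    using assms C by (simp add: infdist_notempty) (rule cINF_greatest, auto simp: divide_le_eq)
  then show ?thesis using C by (simp add: divide_le_eq)
qed

lemma coset_eq_iff:
  fixes L :: "'a::real_vector set"
  assumes L: "subspace L"
  shows "(+) x ` L = (+) y ` L \<longleftrightarrow> x - y \<in> L"
proof
  assume "(+) x ` L = (+) y ` L"
  then have "x + 0 \<in> (+) y ` L" using subspace_0[OF L] by blast
  then show "x - y \<in> L" by auto
next
  assume l: "x - y \<in> L"
  have "x + k \<in> (+) y ` L" if "k \<in> L" for k
    using subspace_add[OF L l that] by (intro image_eqI[of _ _ "x - y + k"]) auto
  moreover have "y + k \<in> (+) x ` L" if "k \<in> L" for k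
    using subspace_diff[OF L that l] by (intro image_eqI[of _ _ "k - (x - y)"]) auto
  ultimately show "(+) x ` L = (+) y ` L" by blast
qed

lemma points_quotient_space: "points (quotient_space L) = range (\<lambda>x. (+) x ` L)"
  by (simp add: quotient_space_def)

lemma bounded_operator_quotient_map:
  fixes L :: "'a::real_normed_vector set"
  assumes L: "subspace L"
  shows "bounded_operator (induced UNIV) (quotient_space L) (\<lambda>x. (+) x ` L)"
proof -
  have "infdist x L \<le> 1 * norm x" for x
    using infdist_le[OF subspace_0[OF L], of x] by (simp add: dist_norm)
  then show ?thesis unfolding bounded_operator_def
    using quotient_space_cosets[OF L] by (auto simp: points_quotient_space intro!: exI[of _ 1])
qed

text \<open>
  The bound survives the passage to the quotient because the value of the form does not change
  when either argument is moved inside its coset, so both norms can be minimised over cosets.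
\<close>

lemma continuous_bilinear_form_descends:
  fixes L :: "'a::real_normed_vector set"
  assumes L: "subspace L" and c: "bounded_bilinear c"
    and cong: "\<And>x y x' y'. x - x' \<in> L \<Longrightarrow> y - y' \<in> L \<Longrightarrow> c x y = c x' y'"
  obtains d where "continuous_bilinear_form (quotient_space L) d"
    and "\<And>x y. d ((+) x ` L) ((+) y ` L) = c x y"
proof -
  let ?\<pi> = "\<lambda>x. (+) x ` L"
  interpret c: bounded_bilinear c by (rule c)
  have L0: "0 \<in> L" using L by (rule subspace_0)
  define d where "d A B = c (SOME x. ?\<pi> x = A) (SOME y. ?\<pi> y = B)" for A B
  have rep: "(SOME z. ?\<pi> z = ?\<pi> x) - x \<in> L" for x
    using someI[of "\<lambda>z. ?\<pi> z = ?\<pi> x" x] coset_eq_iff[OF L] by blast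
  have d: "d (?\<pi> x) (?\<pi> y) = c x y" for x y
    unfolding d_def by (intro cong rep)
  have "\<exists>K. \<forall>x y. \<bar>c x y\<bar> \<le> infdist x L * infdist y L * K"
  proof -
    obtain K where K: "0 \<le> K" "\<And>x y. norm (c x y) \<le> norm x * norm y * K" using c.nonneg_bounded by blast
    have "\<bar>c x y\<bar> \<le> dist x l * (dist y m * K)" if "l \<in> L" "m \<in> L" for x y l m
    proof -
      have "c x y = c (x - l) (y - m)" using that by (intro cong) simp_all
      then show ?thesis using K(2)[of "x - l" "y - m"] by (simp add: dist_norm mult_ac)
    qed
    then have "\<bar>c x y\<bar> \<le> infdist x L * (dist y m * K)" if "m \<in> L" for x y m
      using that K(1) L0 by (intro le_infdist_times) auto
    then have "\<bar>c x y\<bar> \<le> dist y m * (infdist x L * K)" if "m \<in> L" for x y m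
      using that by (simp add: mult_ac)
    then have "\<bar>c x y\<bar> \<le> infdist y L * (infdist x L * K)" for x y
      using K(1) L0 infdist_nonneg by (intro le_infdist_times) auto
    then have "\<bar>c x y\<bar> \<le> infdist x L * infdist y L * K" for x y by (simp add: mult_ac)
    then show ?thesis by blast
  qed
  then have "continuous_bilinear_form (quotient_space L) d"
    unfolding continuous_bilinear_form_def points_quotient_space
    by (auto simp: quotient_space_cosets[OF L] d c.add_left c.add_right c.scaleR_left c.scaleR_right)
  then show thesis using d that by blast
qed

text \<open>
  The semidefinite forms that property (D) of \<open>X\<close> provides for the lifted form \<open>x \<mapsto> q (x + L)\<close>
  need not be constant on cosets. The operator \<open>T\<close> of the lifted form is, since \<open>T x\<close> depends
  on \<open>x + L\<close> only; hence so is every form \<open>\<langle>T x, T y\<rangle>\<close> taken in a dual Hilbert space. The given form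
  \<open>r\<close> is therefore replaced by \<open>s x y = \<langle>T x, T y\<rangle>\<close>, with the inner product dual to \<open>r\<close>. Symmetry of
  \<open>T\<close> turns the estimate of \<open>T\<close> by \<open>r\<close> into one by \<open>s\<close>, and the dominating form built from \<open>s\<close>
  descends to the quotient.
\<close>

lemma property_D_quotient:
  fixes L :: "'a::real_normed_vector set"
  assumes D: "property_D (induced (UNIV :: 'a set))" and L: "subspace L"
  shows "property_D (quotient_space L)"
  unfolding property_D_def
proof (intro allI impI)
  let ?\<pi> = "\<lambda>x. (+) x ` L"
  let ?Q = "quotient_space L"
  fix q assume q: "continuous_quadratic_form ?Q q"
  then obtain b where b: "continuous_bilinear_form ?Q b"
    and qb: "\<And>x. x \<in> points ?Q \<Longrightarrow> q x = b x x"
    by (auto simp: continuous_quadratic_form_def)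
  have "continuous_bilinear_form (induced UNIV) (\<lambda>x y. b (?\<pi> x) (?\<pi> y))"
    by (rule continuous_bilinear_form_pullback[OF b _ bounded_operator_quotient_map[OF L]])
      (auto simp: points_quotient_space quotient_space_cosets(3)[OF L] infdist_nonneg)
  then have "bounded_bilinear (\<lambda>x y. b (?\<pi> x) (?\<pi> y))"
    by (simp add: continuous_bilinear_form_UNIV)
  then obtain T :: "'a \<Rightarrow>\<^sub>L ('a \<Rightarrow>\<^sub>L real)"
    where T: "symmetric_operator T" "\<And>x. T x x = q (?\<pi> x)"
      "\<And>x y. T x y = (b (?\<pi> x) (?\<pi> y) + b (?\<pi> y) (?\<pi> x)) / 2"
    using symmetric_operator_of_quadratic_form[of _ "\<lambda>x. q (?\<pi> x)"] qb points_quotient_space by blast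
  have Tcong: "T x = T y" if "x - y \<in> L" for x y
  proof -
    have "?\<pi> x = ?\<pi> y" using that coset_eq_iff[OF L] by blast
    then show ?thesis by (intro blinfun_eqI) (simp add: T(3))
  qed
  have "delta_semidefinite (induced UNIV) (\<lambda>x. T x x)"
    using D continuous_quadratic_form_operator by (auto simp: property_D_def)
  then obtain r K where r: "semi_inner_product r"
    and K: "\<And>x y. \<bar>T x y\<bar> \<le> K * norm x * sqrt (r y y)"
    using semi_inner_product_of_delta_semidefinite[OF T(1)] by blast
  interpret semi_inner_product r by (rule r)
  define s where "s x y = dual_inner (T x) (T y)" for x y
  have op: "bounded_operator (induced UNIV) dual T" using K by (rule bounded_operator_into_dual)
  have s: "semi_inner_product s"
    unfolding s_def using semi_inner_product_pullback[OF real_normed_space_dual norm_inner_dual op] .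
  obtain M where M: "0 \<le> M" "\<And>x. sqrt (r x x) \<le> M * norm x" using sqrt_bound by blast
  have Ts: "\<bar>T x y\<bar> \<le> M * norm x * sqrt (s y y)" for x y
  proof -
    have Ty: "T y \<in> points dual" using op by (simp add: bounded_operator_def)
    have "\<bar>T x y\<bar> = \<bar>T y x\<bar>" using T(1) by (simp add: symmetric_operator_def)
    also have "\<dots> \<le> dual_norm (T y) * sqrt (r x x)" using Ty by (rule dual_norm_apply)
    also have "\<dots> \<le> dual_norm (T y) * (M * norm x)"
      using M(2) dual_norm_nonneg[OF Ty] by (rule mult_left_mono)
    also have "dual_norm (T y) = sqrt (s y y)"
      using norm_inner_dual Ty dual_norm_nonneg[OF Ty] by (simp add: s_def norm_inner_def)
    finally show ?thesis by (simp add: mult_ac)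
  qed
  define c where "c x y = (s x y + semi_inner_product.dual_inner s (T x) (T y)) / 2" for x y
  have c: "bounded_bilinear c" and cT: "\<bar>T x x\<bar> \<le> c x x" for x
    unfolding c_def using dominating_form[OF s Ts] by blast+
  have "c x y = c x' y'" if "x - x' \<in> L" "y - y' \<in> L" for x y x' y'
    using Tcong[OF that(1)] Tcong[OF that(2)] by (simp add: c_def s_def)
  then obtain d where d: "continuous_bilinear_form ?Q d" "\<And>x y. d (?\<pi> x) (?\<pi> y) = c x y"
    using continuous_bilinear_form_descends[OF L c] by blast
  have "\<bar>q A\<bar> \<le> d A A" if "A \<in> points ?Q" for A
    using that cT T(2) d(2) by (auto simp: points_quotient_space)
  with q d(1) show "delta_semidefinite ?Q q" by (rule delta_semidefiniteI)
qed

theorem corollary1p3: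
  shows "(property_D (induced (UNIV :: 'a::banach set)) \<longleftrightarrow>
            (\<forall>T :: 'a \<Rightarrow>\<^sub>L ('a \<Rightarrow>\<^sub>L real).
               symmetric_operator T \<longrightarrow> factorizable_through_hilbert T)) \<and>
         (property_D (induced (UNIV :: 'a set)) \<longrightarrow>
            (\<forall>L :: 'a set. subspace L \<and> closed L \<longrightarrow> property_D (quotient_space L)) \<and>
            (\<forall>Y :: 'a set. complemented_subspace Y \<longrightarrow> property_D (induced Y)))"
  using property_D_iff_factorizable property_D_quotient property_D_complemented by blast

end
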